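(* In the two-ball, three-box multi-look search game, every non-wasteful deterministic Searcher policy is payoff-equivalent to one of the $72$ elementary decision trees. These $72$ trees generate exactly $42$ distinct six-placement opening-count profiles $(\mathbf N_s(x))_{x\in\mathcal H}$.
   Context: The game. There are three boxes $A,B,C$ with search costs $a\ge b\ge c>0$ respectively. The Hider places two identical balls in the boxes; the placements are $\mathcal H=\{002,011,020,101,110,200\}$, where $x=x_1x_2x_3$ has $x_1,x_2,x_3$ balls in $A,B,C$ respectively. The Searcher opens boxes one at a time. If the opened box currently contains at least one ball, exactly one ball is recovered (removed) and she observes only "success"; otherwise she observes "failure", so she learns that the box is empty. Each next box may depend on the full history. A deterministic Searcher policy $s$ is such an adaptive rule. It is non-wasteful if it never opens a box already known (from the history) to be empty and never continues after both balls have been found. For a deterministic policy $s$ and placement $x$, let $\mathbf N_s(x)=(N_a(x),N_b(x),N_c(x))$ be the numbers of openings of boxes $A,B,C$ made by $s$ against $x$ until both balls are found. The search cost is $C_s(x)=aN_a(x)+bN_b(x)+cN_c(x)$. The (six-placement) opening-count profile of $s$ is the family $(\mathbf N_s(x))_{x\in\mathcal H}$. Two policies are payoff-equivalent if they have the same search cost against every placement. Elementary decision trees. An elementary tree is specified by a first box $i$ ($3$ choices), an ordering $\sigma$ of the three boxes ($6$ choices), and one of $4$ two-box continuations for the other two boxes $\{j,k\}$, giving $3\cdot 6\cdot 4=72$ trees. First open $i$. If this succeeds, inspect the boxes in the order $\sigma$ until the remaining ball is found (each failed opening removes that box from consideration). If the first opening fails, both balls are in the other two boxes; the continuation chooses which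 of them to open next, say $j$ (the other being $k$), and whether, after a success there, to repeat $j$ (continuation $R_{jk}$) or to switch to $k$ (continuation $S_{jk}$); if that next opening fails, the last ball is taken from the other one of the two boxes. If the opening of $j$ fails, both balls are in $k$, which is then opened twice. The four continuations are $R_{jk},S_{jk},R_{kj},S_{kj}$. *)

theory Defs
  imports Complex_Main "HOL-Library.FuncSet"
begin

datatype box = A | B | C

type_synonym placement = "box \<Rightarrow> nat"

definition place :: "nat \<Rightarrow> nat \<Rightarrow> nat \<Rightarrow> placement" where
  "place n1 n2 n3 = (\<lambda>i. case i of A \<Rightarrow> n1 | B \<Rightarrow> n2 | C \<Rightarrow> n3)"

definition placements :: "placement set" where
  "placements = {place 0 0 2, place 0 1 1, place 0 2 0, place 1 0 1, place 1 1 0, place 2 0 0}"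

text \<open>A history lists the opened boxes in chronological order, each with its observation
  (True: success, False: failure).  A policy maps a history to the next box to be opened,
  or to None if the search stops.\<close>

type_synonym history = "(box \<times> bool) list"
type_synonym policy = "history \<Rightarrow> box option"

definition successes :: "history \<Rightarrow> box \<Rightarrow> nat" where
  "successes h i = count_list h (i, True)"

definition found :: "history \<Rightarrow> nat" where
  "found h = length (filter snd h)"

definition remaining :: "placement \<Rightarrow> history \<Rightarrow> box \<Rightarrow> nat" where
  "remaining x h i = x i - successes h i"

text \<open>The history after (at most) \<open>n\<close> openings; it stays constant once the policy stops.\<close>

fun play :: "policy \<Rightarrow> placement \<Rightarrow> nat \<Rightarrow> history" where
  "play s x 0 = []"
| "play s x (Suc n) =
     (let h = play s x n in
      case s h of None \<Rightarrow> h | Some i \<Rightarrow> h @ [(i, remaining x h i > 0)])"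

definition reachable :: "policy \<Rightarrow> history \<Rightarrow> bool" where
  "reachable s h \<longleftrightarrow> (\<exists>x\<in>placements. \<exists>n. h = play s x n)"

definition consistent :: "placement \<Rightarrow> history \<Rightarrow> bool" where
  "consistent x h \<longleftrightarrow>
     (\<forall>n<length h. snd (h ! n) \<longleftrightarrow> remaining x (take n h) (fst (h ! n)) > 0)"

definition known_empty :: "history \<Rightarrow> box \<Rightarrow> bool" where
  "known_empty h i \<longleftrightarrow> (\<forall>x\<in>placements. consistent x h \<longrightarrow> remaining x h i = 0)"

text \<open>A Searcher has to recover both balls, so she may not stop while a ball is missing.\<close>

definition searcher_policy :: "policy \<Rightarrow> bool" where
  "searcher_policy s \<longleftrightarrow> (\<forall>h. reachable s h \<and> found h < 2 \<longrightarrow> s h \<noteq> None)"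

definition non_wasteful :: "policy \<Rightarrow> bool" where
  "non_wasteful s \<longleftrightarrow>
     (\<forall>h i. reachable s h \<and> s h = Some i \<longrightarrow> \<not> known_empty h i) \<and>
     (\<forall>h. reachable s h \<and> found h = 2 \<longrightarrow> s h = None)"

text \<open>The least number below exists whenever the policy finds both balls against \<open>x\<close>; this
  is the case for every non-wasteful Searcher policy.  For other policies the opening counts
  are meaningless.\<close>

definition openings :: "policy \<Rightarrow> placement \<Rightarrow> box \<Rightarrow> nat" where
  "openings s x i = count_list (map fst (play s x (LEAST n. found (play s x n) = 2))) i"

definition opening_counts :: "policy \<Rightarrow> placement \<Rightarrow> nat \<times> nat \<times> nat" where
  "opening_counts s x = (openings s x A, openings s x B, openings s x C)"

definition profile :: "policy \<Rightarrow> placement \<Rightarrow> nat \<times> nat \<times> nat" where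
  "profile s = restrict (opening_counts s) placements"

definition search_cost :: "real \<Rightarrow> real \<Rightarrow> real \<Rightarrow> policy \<Rightarrow> placement \<Rightarrow> real" where
  "search_cost a b c s x =
     (case opening_counts s x of (na, nb, nc) \<Rightarrow> a * real na + b * real nb + c * real nc)"

definition payoff_equivalent :: "real \<Rightarrow> real \<Rightarrow> real \<Rightarrow> policy \<Rightarrow> policy \<Rightarrow> bool" where
  "payoff_equivalent a b c s s' \<longleftrightarrow>
     (\<forall>x\<in>placements. search_cost a b c s x = search_cost a b c s' x)"

text \<open>\<open>Repeat j k\<close> and \<open>Switch j k\<close> are the continuations \<open>R\<^sub>j\<^sub>k\<close> and \<open>S\<^sub>j\<^sub>k\<close>: both open
  \<open>j\<close> first, and after a success there open \<open>j\<close> again or \<open>k\<close>, respectively.\<close>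

datatype continuation = Repeat box box | Switch box box

datatype tree = Tree box "box list" continuation

definition continuations :: "box \<Rightarrow> continuation set" where
  "continuations i =
     {Repeat j k | j k. j \<noteq> k \<and> {j, k} = UNIV - {i}} \<union>
     {Switch j k | j k. j \<noteq> k \<and> {j, k} = UNIV - {i}}"

definition elementary_trees :: "tree set" where
  "elementary_trees =
     {Tree i \<sigma> \<kappa> | i \<sigma> \<kappa>. distinct \<sigma> \<and> set \<sigma> = UNIV \<and> \<kappa> \<in> continuations i}"

text \<open>The history given to a continuation starts after the failed first opening and
  contains at most one success.  Its first entry is the opening of \<open>j\<close>.\<close>

fun continuation_move :: "continuation \<Rightarrow> history \<Rightarrow> box" where
  "continuation_move (Repeat j k) [] = j"
| "continuation_move (Repeat j k) [(_, True)] = j"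
| "continuation_move (Repeat j k) _ = k"
| "continuation_move (Switch j k) [] = j"
| "continuation_move (Switch j k) [(_, True)] = k"
| "continuation_move (Switch j k) ((_, True) # _ # _) = j"
| "continuation_move (Switch j k) ((_, False) # _) = k"

text \<open>After a successful first opening, the next box is the first one in the order \<open>\<sigma>\<close> whose
  opening has not failed yet.  (The value on histories not produced by the tree itself is
  irrelevant.)\<close>

fun tree_policy :: "tree \<Rightarrow> policy" where
  "tree_policy (Tree i \<sigma> \<kappa>) h =
     (if found h \<ge> 2 then None
      else case h of
        [] \<Rightarrow> Some i
      | (_, True) # h' \<Rightarrow> find (\<lambda>j. (j, False) \<notin> set h') \<sigma>
      | (_, False) # h' \<Rightarrow> Some (continuation_move \<kappa> h'))"

end

theory Submission imports Defs begin

text \<open>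
  A box whose opening has failed is known to be empty, so a non-wasteful Searcher never opens it
  again, and while a ball is missing at most two boxes can have failed.  After a first success in
  \<open>i\<close> the last ball may be in any box, and what remains of the policy is the order in which the
  boxes are tried.  After a first failure it remains to choose a box \<open>j\<close> among the other two and,
  if it succeeds, whether to repeat \<open>j\<close> or to switch.  All other moves are forced.  Reading these
  choices off a policy gives an elementary tree that agrees with it on every reachable history
  (\<open>non_wasteful_agrees_with_tree\<close>); so both produce the same play against each placement
  (\<open>play_cong_reachable\<close>), hence the same opening counts and costs.

  The number of profiles is found by evaluating all 72 trees (\<open>number_of_profile_lists\<close>), each
  of which finds both balls within four openings.  The outcome 42 can be understood as follows.
  Only two mechanisms identify trees.
  First, \<open>Switch j k\<close> and \<open>Switch k j\<close> have the same opening counts: both balls are in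
  \<open>j\<close> and \<open>k\<close>, and either way one opening of each is followed, if one of them failed, by a second
  opening of the other.  This leaves \<open>3 \<sqdot> 6 \<sqdot> 3 = 54\<close> classes.  Second, if a tree opens \<open>i\<close> and then
  \<open>j\<close> whatever happens at \<open>i\<close>, the two openings may be exchanged.  For each of the three pairs of
  boxes, such a tree is determined up to the first identification by two binary choices: the box
  tried after \<open>i\<close> alone has succeeded, and the box tried after \<open>j\<close> alone has succeeded.  A class
  occurs in at most one such exchange, since the pair has to consist of its first box and the box
  that it tries after a success there.  So
  \<open>3 \<sqdot> 4 = 12\<close> pairs of classes are merged, and \<open>54 - 12 = 42\<close> classes are left.
\<close>

section \<open>Boxes and placements\<close>

lemma UNIV_box: "(UNIV :: box set) = {A, B, C}"
  using box.exhaust by auto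

lemma box_cases_distinct: "distinct [p, q, r] \<Longrightarrow> m = p \<or> m = q \<or> m = (r :: box)"
  by (cases p; cases q; cases r; cases m) simp_all

lemma third_box: "p \<noteq> q \<Longrightarrow> \<exists>r :: box. distinct [p, q, r]"
  using box.distinct by (cases p; cases q) auto

lemma placements_iff: "x \<in> placements \<longleftrightarrow> x A + x B + x C = 2"
proof
  assume sum: "x A + x B + x C = 2"
  have "x = place (x A) (x B) (x C)"
    by (auto simp: place_def fun_eq_iff split: box.split)
  moreover have "place l m (2 - l - m) \<in> placements" if "l + m \<le> 2" for l m
  proof -
    have "l \<in> {0, 1, 2}" "m \<in> {0, 1, 2}" using that by auto
    with that show ?thesis by (auto simp: placements_def)
  qed
  moreover have "x C = 2 - x A - x B" "x A + x B \<le> 2"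
    using sum by simp_all
  ultimately show "x \<in> placements" by metis
qed (auto simp: placements_def place_def)

lemma both_balls_placement: "(\<lambda>_. 0)(i := 2) \<in> placements"
  by (cases i) (simp_all add: placements_iff)

lemma one_ball_each_placement: "i \<noteq> j \<Longrightarrow> (\<lambda>_. 0)(i := 1, j := 1) \<in> placements"
  by (cases i; cases j) (simp_all add: placements_iff)

section \<open>Reachable histories\<close>

lemma successes_snoc: "successes (h @ [(i, ok)]) m = successes h m + (if m = i \<and> ok then 1 else 0)"
  by (auto simp: successes_def)

lemma found_eq_successes: "found h = successes h A + successes h B + successes h C"
  unfolding found_def successes_def
proof (induction h)
  case (Cons e h)
  then show ?case by (cases e; cases "fst e") auto
qed simp

lemma found_snoc: "found (h @ [(i, ok)]) = found h + (if ok then 1 else 0)"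
  by (simp add: found_def)

lemma play_successes:
  "successes (play s x n) i \<le> x i \<and> ((i, False) \<in> set (play s x n) \<longrightarrow> successes (play s x n) i = x i)"
  by (induction n)
     (auto simp: Let_def successes_snoc remaining_def split: option.split,
      simp_all add: successes_def)

lemma reachable_found_le:
  assumes "reachable s h"
  shows "found h \<le> 2"
proof -
  obtain x n where "x \<in> placements" and "h = play s x n"
    using assms by (auto simp: reachable_def)
  then show ?thesis
    using play_successes[of s x n A] play_successes[of s x n B] play_successes[of s x n C]
    by (simp add: found_eq_successes placements_iff)
qed

text \<open>A box that has failed has given up all of its balls, so three failures account for both
  balls.  After two failures, opening the third box is thus certain to succeed.\<close>

lemma not_all_boxes_failed:
  assumes "reachable s h" and "found h < 2" and "distinct [p, q, r]"
  shows "\<not> {(p, False), (q, False), (r, False)} \<subseteq> set h"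
proof
  assume failed: "{(p, False), (q, False), (r, False)} \<subseteq> set h"
  obtain x n where x: "x \<in> placements" and h: "h = play s x n"
    using assms(1) by (auto simp: reachable_def)
  have "successes h m = x m" for m
    using box_cases_distinct[OF assms(3), of m] failed play_successes[of s x n m] h by auto
  with x assms(2) show False
    by (simp add: placements_iff found_eq_successes)
qed

lemma consistent_Nil: "consistent x []"
  by (simp add: consistent_def)

lemma consistent_snoc:
  "consistent x (h @ [(i, ok)]) \<longleftrightarrow> consistent x h \<and> (ok \<longleftrightarrow> remaining x h i > 0)"
  unfolding consistent_def by (auto simp: nth_append less_Suc_eq)

lemma failed_known_empty:
  assumes "(i, False) \<in> set h"
  shows "known_empty h i"
proof -
  have "remaining x h i = 0" if "consistent x h" for x
    using that assms
    by (induction h rule: rev_induct)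
       (auto simp: consistent_snoc remaining_def successes_snoc)
  then show ?thesis by (simp add: known_empty_def)
qed

lemma reachable_Nil: "reachable s []"
  unfolding reachable_def using both_balls_placement play.simps(1) by metis

lemma reachable_snocD:
  assumes "reachable s (h @ [(i, ok)])"
  shows "reachable s h" and "s h = Some i"
proof -
  obtain x n where x: "x \<in> placements" and "play s x n = h @ [(i, ok)]"
    using assms by (auto simp: reachable_def)
  then have "\<exists>m. play s x m = h \<and> s h = Some i"
    by (induction n) (auto simp: Let_def split: option.splits)
  with x show "reachable s h" "s h = Some i"
    by (auto simp: reachable_def)
qed

text \<open>The play depends on the placement only through the observations.  Reachable histories can
  therefore be extended using a different witness placement at every step.\<close>

lemma reachable_consistent_play:
  "reachable s h \<Longrightarrow> consistent x h \<Longrightarrow> play s x (length h) = h"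
proof (induction h rule: rev_induct)
  case (snoc e h)
  obtain i ok where e: "e = (i, ok)" by fastforce
  with snoc reachable_snocD[of s h i ok] show ?case
    by (auto simp: consistent_snoc)
qed simp

lemma reachable_snocI:
  assumes "reachable s h" "s h = Some i" "x \<in> placements" "consistent x (h @ [(i, ok)])"
  shows "reachable s (h @ [(i, ok)])"
proof -
  have "play s x (length h) = h"
    using assms by (simp add: consistent_snoc reachable_consistent_play)
  then have "play s x (Suc (length h)) = h @ [(i, ok)]"
    using assms by (simp add: consistent_snoc)
  with assms(3) show ?thesis unfolding reachable_def by metis
qed

lemma play_cong_reachable:
  assumes "\<And>h. reachable s h \<Longrightarrow> s' h = s h" and "x \<in> placements"
  shows "play s' x n = play s x n"
proof (induction n)
  case (Suc n)
  have "reachable s (play s x n)" using assms(2) by (auto simp: reachable_def)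
  with Suc assms(1) show ?case by simp
qed simp

section \<open>Non-wasteful policies are elementary trees\<close>

lemma next_box_not_failed:
  assumes "searcher_policy s" "non_wasteful s" "reachable s h" "found h < 2"
  obtains i where "s h = Some i" and "(i, False) \<notin> set h"
  using assms failed_known_empty unfolding searcher_policy_def non_wasteful_def by blast

lemma continuations_iff:
  "\<kappa> \<in> continuations i \<longleftrightarrow> (\<exists>j k. distinct [i, j, k] \<and> (\<kappa> = Repeat j k \<or> \<kappa> = Switch j k))"
proof -
  have "j \<noteq> k \<and> {j, k} = UNIV - {i} \<longleftrightarrow> distinct [i, j, k]" for j k
    using box_cases_distinct[of i j k] by auto
  then show ?thesis unfolding continuations_def Un_iff mem_Collect_eq by metis
qed

lemma box_order_iff:
  "distinct \<sigma> \<and> set \<sigma> = (UNIV :: box set) \<longleftrightarrow> (\<exists>p q r. \<sigma> = [p, q, r] \<and> distinct [p, q, r])"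
proof
  assume \<sigma>: "distinct \<sigma> \<and> set \<sigma> = UNIV"
  then have "length \<sigma> = 3"
    using distinct_card[of \<sigma>] by (simp add: UNIV_box)
  with \<sigma> show "\<exists>p q r. \<sigma> = [p, q, r] \<and> distinct [p, q, r]"
    by (auto simp: length_Suc_conv numeral_3_eq_3)
next
  assume "\<exists>p q r. \<sigma> = [p, q, r] \<and> distinct [p, q, r]"
  then show "distinct \<sigma> \<and> set \<sigma> = UNIV"
    using box_cases_distinct by fastforce
qed

text \<open>The tree is read off from the moves after five histories: the empty one, a success, a success
  and a failure, a failure, a failure and a success.  Each of them is reachable, which is why the
  moves satisfy the side conditions of an elementary tree.  The four other reachable histories with
  a ball missing leave just one box that has not failed, to the policy as to the tree.\<close>

lemma non_wasteful_agrees_with_tree: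
  assumes s: "searcher_policy s" "non_wasteful s"
  obtains t where "t \<in> elementary_trees" and "\<And>h. reachable s h \<Longrightarrow> tree_policy t h = s h"
proof -
  note next_box = next_box_not_failed[OF s]
  note consistent_simps = consistent_snoc[of _ "[]", simplified] consistent_snoc[of _ "[_]", simplified]
    consistent_Nil remaining_def successes_def
  obtain i where s0: "s [] = Some i"
    using next_box[OF reachable_Nil] by (auto simp: found_def)
  obtain m where "m \<noteq> i" using box.distinct by metis

  have rT: "reachable s [(i, True)]"
    using reachable_snocI[OF reachable_Nil[of s] s0 both_balls_placement[of i], of True]
    by (simp add: consistent_simps)
  obtain p where sT: "s [(i, True)] = Some p"
    using next_box[OF rT] by (auto simp: found_def)
  have rTF: "reachable s [(i, True), (p, False)]"
  proof (cases "p = i")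
    case True
    then show ?thesis
      using reachable_snocI[OF rT sT one_ball_each_placement[OF \<open>m \<noteq> i\<close>], of False] \<open>m \<noteq> i\<close>
      by (simp add: consistent_simps)
  next
    case False
    then show ?thesis
      using reachable_snocI[OF rT sT both_balls_placement[of i], of False]
      by (simp add: consistent_simps)
  qed
  obtain q where sTF: "s [(i, True), (p, False)] = Some q" and "q \<noteq> p"
    using next_box[OF rTF] by (auto simp: found_def)
  obtain r where pqr: "distinct [p, q, r]"
    using third_box \<open>q \<noteq> p\<close> by metis

  have rF: "reachable s [(i, False)]"
    using reachable_snocI[OF reachable_Nil[of s] s0 both_balls_placement[of m], of False] \<open>m \<noteq> i\<close>
    by (simp add: consistent_simps)
  obtain j where sF: "s [(i, False)] = Some j" and "j \<noteq> i"
    using next_box[OF rF] by (auto simp: found_def)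
  obtain k where ijk: "distinct [i, j, k]"
    using third_box \<open>j \<noteq> i\<close> by metis
  have rFT: "reachable s [(i, False), (j, True)]"
    using reachable_snocI[OF rF sF both_balls_placement[of j], of True] \<open>j \<noteq> i\<close>
    by (simp add: consistent_simps)
  obtain l where sFT: "s [(i, False), (j, True)] = Some l" and "l \<noteq> i"
    using next_box[OF rFT] by (auto simp: found_def)
  then have l: "l = j \<or> l = k"
    using box_cases_distinct[OF ijk] by auto

  define \<kappa> where "\<kappa> = (if l = j then Repeat j k else Switch j k)"
  define t where "t = Tree i [p, q, r] \<kappa>"
  have "t \<in> elementary_trees"
    unfolding t_def \<kappa>_def elementary_trees_def
    using ijk pqr box_order_iff[of "[p, q, r]"] continuations_iff by auto

  have tree_moves:
    "tree_policy t [] = Some i"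
    "tree_policy t [(i, True)] = Some p"
    "tree_policy t [(i, True), (p, False)] = Some q"
    "tree_policy t [(i, True), (p, False), (q, False)] = Some r"
    "tree_policy t [(i, False)] = Some j"
    "tree_policy t [(i, False), (j, True)] = Some l"
    "tree_policy t [(i, False), (j, True), (l, False)] = Some (if l = j then k else j)"
    "tree_policy t [(i, False), (j, False)] = Some k"
    "tree_policy t [(i, False), (j, False), (k, True)] = Some k"
    using l ijk pqr by (auto simp: t_def \<kappa>_def found_def)

  \<comment> \<open>The histories that can be reached while a ball is missing.\<close>
  define S where "S =
    {[], [(i, True)], [(i, True), (p, False)], [(i, True), (p, False), (q, False)],
     [(i, False)], [(i, False), (j, True)], [(i, False), (j, True), (l, False)],
     [(i, False), (j, False)], [(i, False), (j, False), (k, True)]}"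
  have agree: "tree_policy t h = s h" if "h \<in> S" and h: "reachable s h" for h
  proof -
    have "found h < 2" using \<open>h \<in> S\<close> by (auto simp: S_def found_def)
    with h obtain b where b: "s h = Some b" "(b, False) \<notin> set h"
      by (rule next_box)
    have "b = i \<or> b = j \<or> b = k" "b = p \<or> b = q \<or> b = r"
      using box_cases_distinct ijk pqr by blast+
    with b \<open>h \<in> S\<close> l show ?thesis
      unfolding S_def
      by (elim insertE emptyE) (simp_all only: tree_moves s0 sT sTF sF sFT, auto)
  qed
  have S: "h \<in> S" if "reachable s h" "found h < 2" for h
    using that
  proof (induction h rule: rev_induct)
    case Nil
    show ?case by (simp add: S_def)
  next
    case (snoc e h)
    obtain b ok where e: "e = (b, ok)" by fastforce
    have h: "reachable s h" "s h = Some b"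
      using snoc.prems(1) reachable_snocD unfolding e by blast+
    have "h \<in> S"
      using snoc h(1) by (simp add: e found_snoc)
    then have b: "tree_policy t h = Some b"
      using agree h by simp
    have e_last: "reachable s (h @ [(b, ok)])" "found (h @ [(b, ok)]) < 2"
      using snoc.prems unfolding e by simp_all
    note not_all_failed = not_all_boxes_failed[OF e_last pqr] not_all_boxes_failed[OF e_last ijk]
    from \<open>h \<in> S\<close>[unfolded S_def] b e_last(2) not_all_failed l have "h @ [(b, ok)] \<in> S"
      by (elim insertE emptyE; cases ok) (simp_all only: tree_moves, auto simp: found_def S_def)
    then show ?case by (simp add: e)
  qed
  have "tree_policy t h = s h" if h: "reachable s h" for h
  proof (cases "found h < 2")
    case True
    then show ?thesis using agree S h by blast
  next
    case False
    then have "s h = None"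
      using reachable_found_le[OF h] s h unfolding non_wasteful_def by force
    with False show ?thesis by (simp add: t_def)
  qed
  with \<open>t \<in> elementary_trees\<close> show ?thesis by (rule that)
qed

section \<open>Enumeration of the trees and their profiles\<close>

definition box_list :: "box list" where
  "box_list = [A, B, C]"

definition box_orders :: "box list list" where
  "box_orders = [[p, q, r]. p \<leftarrow> box_list, q \<leftarrow> box_list, r \<leftarrow> box_list, distinct [p, q, r]]"

definition continuation_list :: "box \<Rightarrow> continuation list" where
  "continuation_list i =
     [\<kappa> j k. \<kappa> \<leftarrow> [Repeat, Switch], j \<leftarrow> box_list, k \<leftarrow> box_list, distinct [i, j, k]]"

definition tree_list :: "tree list" where
  "tree_list = [Tree i \<sigma> \<kappa>. i \<leftarrow> box_list, \<sigma> \<leftarrow> box_orders, \<kappa> \<leftarrow> continuation_list i]"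

definition placement_list :: "placement list" where
  "placement_list =
     [place 0 0 2, place 0 1 1, place 0 2 0, place 1 0 1, place 1 1 0, place 2 0 0]"

lemma set_box_list: "set box_list = UNIV"
  by (simp add: box_list_def UNIV_box)

lemma mem_box_orders: "\<sigma> \<in> set box_orders \<longleftrightarrow> distinct \<sigma> \<and> set \<sigma> = UNIV"
  unfolding box_order_iff box_orders_def by (auto simp: set_box_list)

lemma set_continuation_list: "set (continuation_list i) = continuations i"
  unfolding set_eq_iff continuations_iff continuation_list_def by (auto simp: set_box_list)

lemma set_tree_list: "set tree_list = elementary_trees"
  unfolding tree_list_def elementary_trees_def
  by (auto simp: set_box_list mem_box_orders set_continuation_list image_iff)

lemma placements_eq_set: "placements = set placement_list"
  by (simp add: placements_def placement_list_def)

definition counts_within :: "nat \<Rightarrow> policy \<Rightarrow> placement \<Rightarrow> nat \<times> nat \<times> nat" where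
  "counts_within n s x =
     (let bs = map fst (play s x n) in (count_list bs A, count_list bs B, count_list bs C))"

lemma play_stopped: "s (play s x m) = None \<Longrightarrow> play s x (m + d) = play s x m"
  by (induction d) simp_all

text \<open>The play of a policy that stops is constant from then on, so the least number of openings
  in the definition of the opening counts may be replaced by any number that suffices.\<close>

lemma opening_counts_eq_counts_within:
  assumes stop: "\<And>h. found h = 2 \<Longrightarrow> s h = None" and "found (play s x n) = 2"
  shows "opening_counts s x = counts_within n s x"
proof -
  define m where "m = (LEAST n. found (play s x n) = 2)"
  have "found (play s x m) = 2" and "m \<le> n"
    unfolding m_def using assms(2) by (auto intro: LeastI Least_le)
  then have "play s x m = play s x n"
    using play_stopped[of s x m "n - m"] stop by simp
  then show ?thesis
    by (simp add: opening_counts_def openings_def counts_within_def Let_def flip: m_def)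
qed

definition profile_list :: "tree \<Rightarrow> (nat \<times> nat \<times> nat) list" where
  "profile_list t = map (counts_within 4 (tree_policy t)) placement_list"

text \<open>All four openings are used, for instance, after a first success when the last ball is in
  the box that the order tries at the end.\<close>

lemma trees_finish_within_four:
  "\<forall>t\<in>set tree_list. \<forall>x\<in>set placement_list. found (play (tree_policy t) x 4) = 2"
  by code_simp

lemma distinct_tree_list: "distinct tree_list"
  by code_simp

lemma length_tree_list: "length tree_list = 72"
  by code_simp

lemma number_of_profile_lists: "length (remdups (map profile_list tree_list)) = 42"
  by code_simp

lemma profile_list_eq:
  assumes "t \<in> elementary_trees"
  shows "profile_list t = map (profile (tree_policy t)) placement_list"
proof -
  have "tree_policy t h = None" if "found h = 2" for h
    using that by (cases t) simp
  then have "opening_counts (tree_policy t) x = counts_within 4 (tree_policy t) x"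
    if "x \<in> placements" for x
    using that assms trees_finish_within_four opening_counts_eq_counts_within
    by (simp add: set_tree_list placements_eq_set)
  then show ?thesis
    unfolding profile_list_def map_eq_conv by (simp add: profile_def flip: placements_eq_set)
qed

text \<open>Profiles are undefined outside the placements, so the six values determine them; they may be
  counted as lists, which can be compared by evaluation.\<close>

lemma inj_on_profile_values:
  "inj_on (\<lambda>f. map f placement_list) (range profile)"
proof (rule inj_onI)
  fix f g assume fg: "f \<in> range profile" "g \<in> range profile"
    and "map f placement_list = map g placement_list"
  then have "f x = g x" if "x \<in> placements" for x
    using that unfolding map_eq_conv placements_eq_set by blast
  with fg show "f = g"
    by (force simp: profile_def restrict_def fun_eq_iff)
qed

lemma card_profiles: "card ((\<lambda>t. profile (tree_policy t)) ` elementary_trees) = 42"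
proof -
  let ?P = "(\<lambda>t. profile (tree_policy t)) ` elementary_trees"
  have "card ?P = card ((\<lambda>f. map f placement_list) ` ?P)"
    by (rule card_image[symmetric], rule inj_on_subset[OF inj_on_profile_values]) auto
  also have "(\<lambda>f. map f placement_list) ` ?P = profile_list ` elementary_trees"
    by (auto simp: profile_list_eq image_iff)
  also have "\<dots> = set (map profile_list tree_list)"
    by (simp add: set_tree_list)
  also have "card \<dots> = 42"
    unfolding card_set by (rule number_of_profile_lists)
  finally show ?thesis .
qed

theorem proposition1:
  fixes a b c :: real
  assumes "a \<ge> b" and "b \<ge> c" and "c > 0"
  shows "(\<forall>s. searcher_policy s \<and> non_wasteful s \<longrightarrow>
             (\<exists>t\<in>elementary_trees. payoff_equivalent a b c s (tree_policy t)))
       \<and> card elementary_trees = 72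
       \<and> card ((\<lambda>t. profile (tree_policy t)) ` elementary_trees) = 42"
proof (intro conjI allI impI)
  fix s assume "searcher_policy s \<and> non_wasteful s"
  then obtain t where "t \<in> elementary_trees"
    and "\<And>h. reachable s h \<Longrightarrow> tree_policy t h = s h"
    using non_wasteful_agrees_with_tree by blast
  then have "play (tree_policy t) x n = play s x n" if "x \<in> placements" for x n
    using that play_cong_reachable by blast
  then have "opening_counts (tree_policy t) x = opening_counts s x" if "x \<in> placements" for x
    using that by (simp add: opening_counts_def openings_def)
  then show "\<exists>t\<in>elementary_trees. payoff_equivalent a b c s (tree_policy t)"
    using \<open>t \<in> elementary_trees\<close>
    unfolding payoff_equivalent_def search_cost_def by metis
next
  show "card elementary_trees = 72"
    using distinct_card[OF distinct_tree_list] by (simp add: set_tree_list length_tree_list)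
qed (rule card_profiles)

end
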